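(* Let $G$ be a connected graph with $n$ vertices and $m$ edges. Then $tmc(G)=m+n-2$ if and only if $G=K_n-K_2$.
   Context: All graphs are simple, finite and undirected. A graph is total-colored if all its edges and all its vertices are assigned colors. A path in a total-colored graph is a total monochromatic path if all its edges and all its internal vertices have the same color. A total-coloring is a TMC-coloring if any two vertices are connected by a total monochromatic path. For a connected graph $G$, $tmc(G)$ is the maximum number of colors used in a TMC-coloring of $G$. For a graph $H$, $K_n-H$ denotes the graph obtained from the complete graph $K_n$ by deleting the edges of a copy of $H$ in $K_n$; thus $K_n-K_2$ is $K_n$ with one edge removed. *)

theory Defs
  imports Main "HOL-Library.Ramsey"
begin

record 'a ugraph =
  verts :: "'a set"
  edges :: "'a set set"

definition simple_graph :: "'a ugraph \<Rightarrow> bool" where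
  "simple_graph G \<longleftrightarrow> finite (verts G) \<and> edges G \<subseteq> nsets (verts G) 2"

definition path_edges :: "'a list \<Rightarrow> 'a set set" where
  "path_edges p = {{p ! i, p ! Suc i} | i. Suc i < length p}"

definition internal_verts :: "'a list \<Rightarrow> 'a set" where
  "internal_verts p = set (butlast (tl p))"

text \<open>The one-vertex list is the trivial path from a vertex to itself.\<close>

definition path_between :: "'a ugraph \<Rightarrow> 'a \<Rightarrow> 'a list \<Rightarrow> 'a \<Rightarrow> bool" where
  "path_between G u p v \<longleftrightarrow>
     p \<noteq> [] \<and> hd p = u \<and> last p = v \<and> distinct p \<and>
     set p \<subseteq> verts G \<and> path_edges p \<subseteq> edges G"

definition connected_graph :: "'a ugraph \<Rightarrow> bool" where
  "connected_graph G \<longleftrightarrow>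
     simple_graph G \<and> verts G \<noteq> {} \<and>
     (\<forall>u\<in>verts G. \<forall>v\<in>verts G. \<exists>p. path_between G u p v)"

text \<open>
  A total-coloring is a pair of maps \<open>cv\<close> on vertices and \<open>ce\<close> on edges into one common set of
  colors; as graphs are finite, natural numbers suffice as colors. Only the values on
  \<open>verts G\<close> and \<open>edges G\<close> matter. Colorings need not be proper.
\<close>

definition total_monochromatic :: "('a \<Rightarrow> nat) \<Rightarrow> ('a set \<Rightarrow> nat) \<Rightarrow> 'a list \<Rightarrow> bool" where
  "total_monochromatic cv ce p \<longleftrightarrow>
     (\<exists>c. (\<forall>e\<in>path_edges p. ce e = c) \<and> (\<forall>x\<in>internal_verts p. cv x = c))"

definition tmc_coloring :: "'a ugraph \<Rightarrow> ('a \<Rightarrow> nat) \<Rightarrow> ('a set \<Rightarrow> nat) \<Rightarrow> bool" where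
  "tmc_coloring G cv ce \<longleftrightarrow>
     (\<forall>u\<in>verts G. \<forall>v\<in>verts G. \<exists>p. path_between G u p v \<and> total_monochromatic cv ce p)"

definition colors_used :: "'a ugraph \<Rightarrow> ('a \<Rightarrow> nat) \<Rightarrow> ('a set \<Rightarrow> nat) \<Rightarrow> nat set" where
  "colors_used G cv ce = cv ` verts G \<union> ce ` edges G"

text \<open>
  For connected \<open>G\<close> the set below is nonempty (use a single color) and bounded by the number of
  vertices plus the number of edges, so the maximum is meaningful.
\<close>

definition tmc :: "'a ugraph \<Rightarrow> nat" where
  "tmc G = Max {card (colors_used G cv ce) | cv ce. tmc_coloring G cv ce}"

definition graph_iso :: "'a ugraph \<Rightarrow> 'b ugraph \<Rightarrow> bool" where
  "graph_iso G H \<longleftrightarrow>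
     (\<exists>f. bij_betw f (verts G) (verts H) \<and> edges H = image f ` edges G)"

definition complete_graph :: "nat \<Rightarrow> nat ugraph" where
  "complete_graph n = \<lparr>verts = {..<n}, edges = nsets {..<n} 2\<rparr>"

text \<open>
  \<open>is_complete_minus n H G\<close>: up to isomorphism, \<open>G\<close> is $K_n - H$. The map \<open>g\<close> embeds \<open>H\<close> as a
  copy inside $K_n$; in particular \<open>H\<close> has at most \<open>n\<close> vertices.
\<close>

definition is_complete_minus :: "nat \<Rightarrow> 'b ugraph \<Rightarrow> 'a ugraph \<Rightarrow> bool" where
  "is_complete_minus n H G \<longleftrightarrow>
     (\<exists>g. inj_on g (verts H) \<and> g ` verts H \<subseteq> verts (complete_graph n) \<and>
        graph_iso G \<lparr>verts = verts (complete_graph n),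
                     edges = edges (complete_graph n) - image g ` edges H\<rparr>)"

end

theory Submission
  imports Defs
begin

text \<open>
  Regard the vertices and edges together as \<open>m + n\<close> colored elements. A pair of adjacent vertices
  imposes no condition, whereas a total monochromatic path between two nonadjacent vertices contains
  two edges and an inner vertex of one color, which costs two colors. A single nonadjacent pair
  costs exactly two, by a path of length two. Two nonadjacent pairs cost at least three:
  their paths either have different colors and cost two each, or they share a color, and then this
  color class has at least four elements, because two edges meeting in a vertex determine
  the pair of their other ends.
\<close>

section \<open>Colors as the image of one finite set\<close>

text \<open>The disjoint sum turns a total-coloring into the single map
  \<open>case_sum cv ce\<close>, so that losing colors means failing to be injective.\<close>

definition elements :: "'a ugraph \<Rightarrow> ('a + 'a set) set" where
  "elements G = verts G <+> edges G"

lemma simple_graph_finite: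
  assumes "simple_graph G"
  shows "finite (verts G)" "finite (edges G)"
  using assms finite_imp_finite_nsets[of "verts G" 2] finite_subset
  by (auto simp: simple_graph_def)

lemma finite_elements: "simple_graph G \<Longrightarrow> finite (elements G)"
  by (simp add: elements_def simple_graph_finite)

lemma card_elements: "simple_graph G \<Longrightarrow> card (elements G) = card (verts G) + card (edges G)"
  by (simp add: elements_def simple_graph_finite card_Plus)

lemma colors_used_eq_image: "colors_used G cv ce = case_sum cv ce ` elements G"
  unfolding colors_used_def elements_def by force

lemma card_colors_used_le:
  assumes "simple_graph G"
  shows "card (colors_used G cv ce) \<le> card (elements G)"
  by (simp add: colors_used_eq_image card_image_le finite_elements assms)

lemma finite_tmc_set:
  assumes "simple_graph G"
  shows "finite {card (colors_used G cv ce) | cv ce. tmc_coloring G cv ce}"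
  by (rule finite_subset[of _ "{..card (elements G)}"]) (auto simp: card_colors_used_le assms)

lemma card_colors_used_le_tmc:
  assumes "simple_graph G" "tmc_coloring G cv ce"
  shows "card (colors_used G cv ce) \<le> tmc G"
  unfolding tmc_def by (rule Max_ge) (use assms finite_tmc_set in auto)

lemma tmc_coloring_const: "connected_graph G \<Longrightarrow> tmc_coloring G (\<lambda>_. c) (\<lambda>_. c)"
  by (auto simp: tmc_coloring_def connected_graph_def total_monochromatic_def)

text \<open>Bounding the \<open>Max\<close> needs a nonempty set of values; connectedness supplies
  the coloring with one color.\<close>

lemma tmc_le:
  assumes "connected_graph G"
    and "\<And>cv ce. tmc_coloring G cv ce \<Longrightarrow> card (colors_used G cv ce) \<le> k"
  shows "tmc G \<le> k"
proof -
  let ?C = "{card (colors_used G cv ce) | cv ce. tmc_coloring G cv ce}"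
  have "finite ?C" using assms(1) by (simp add: finite_tmc_set connected_graph_def)
  moreover have "?C \<noteq> {}" using tmc_coloring_const[OF assms(1)] by blast
  ultimately show ?thesis using assms(2) unfolding tmc_def by (subst Max_le_iff) auto
qed

section \<open>Monochromatic paths and nonadjacent vertices\<close>

lemma path_edges_Cons: "path_edges (x # y # p) = insert {x, y} (path_edges (y # p))"
proof -
  have "(\<exists>i. e = {(x # y # p) ! i, (x # y # p) ! Suc i} \<and> Suc i < length (x # y # p)) \<longleftrightarrow>
    e = {x, y} \<or> (\<exists>i. e = {(y # p) ! i, (y # p) ! Suc i} \<and> Suc i < length (y # p))"
    (is "?L \<longleftrightarrow> ?R") for e
  proof
    assume ?L
    then obtain i where "e = {(x # y # p) ! i, (x # y # p) ! Suc i}" "Suc i < length (x # y # p)"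
      by blast
    then show ?R by (cases i) auto
  next
    assume ?R
    then show ?L
    proof
      assume "e = {x, y}"
      then show ?thesis by (intro exI[of _ 0]) simp
    next
      assume "\<exists>i. e = {(y # p) ! i, (y # p) ! Suc i} \<and> Suc i < length (y # p)"
      then obtain i where "e = {(y # p) ! i, (y # p) ! Suc i} \<and> Suc i < length (y # p)" ..
      then show ?thesis by (intro exI[of _ "Suc i"]) simp
    qed
  qed
  then show ?thesis by (auto simp: path_edges_def)
qed

lemma path_edges_singleton: "path_edges [x] = {}"
  by (simp add: path_edges_def)

text \<open>Counterpart of \<open>path_edges_Cons\<close> at the other end, needed to reach the last
  edge of a path. The induction treats two leading vertices at a time because that rule
  does.\<close>

lemma path_edges_last: "path_edges (p @ [y, v]) = insert {y, v} (path_edges (p @ [y]))"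
proof (induction p rule: induct_list012)
  case 1
  then show ?case by (simp add: path_edges_Cons path_edges_singleton)
next
  case (2 x)
  then show ?case by (auto simp: path_edges_Cons path_edges_singleton)
next
  case (3 x z p)
  then show ?case by (auto simp: path_edges_Cons)
qed

text \<open>The inner vertices \<open>x\<close> and \<open>y\<close> of the path may coincide.\<close>

lemma nonadjacent_monochromatic:
  assumes "tmc_coloring G cv ce" "u \<in> verts G" "v \<in> verts G" "u \<noteq> v" "{u, v} \<notin> edges G"
  obtains c x y where "x \<in> verts G" "y \<in> verts G" "x \<notin> {u, v}" "y \<notin> {u, v}"
    "{u, x} \<in> edges G" "{y, v} \<in> edges G"
    "cv x = c" "cv y = c" "ce {u, x} = c" "ce {y, v} = c"
proof -
  obtain p where p: "path_between G u p v" "total_monochromatic cv ce p"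
    using assms by (auto simp: tmc_coloring_def)
  obtain q where q: "p = u # q"
    using p(1) by (cases p) (auto simp: path_between_def)
  with p(1) assms(4) have "q \<noteq> []" by (auto simp: path_between_def)
  then obtain r where r: "p = u # r @ [v]"
    using p(1) q by (cases q rule: rev_cases) (auto simp: path_between_def)
  \<comment> \<open>Otherwise the path is \<open>[u, v]\<close>, whose only edge is missing from
    \<open>G\<close>.\<close>
  have "r \<noteq> []"
    using p(1) r assms(5) by (auto simp: path_between_def path_edges_Cons)
  then obtain x s where s: "r = x # s" by (cases r) auto
  obtain y t where t: "r = t @ [y]" using \<open>r \<noteq> []\<close> by (cases r rule: rev_cases) auto
  have "{u, x} \<in> path_edges p" by (simp add: r s path_edges_Cons)
  moreover have "{y, v} \<in> path_edges p"
    using path_edges_last[of "u # t" y v] by (simp add: r t)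
  moreover have "internal_verts p = set r"
    by (simp add: internal_verts_def r)
  moreover have "x \<in> set r" "y \<in> set r" by (simp add: s, simp add: t)
  moreover obtain c where "\<forall>e\<in>path_edges p. ce e = c" "\<forall>a\<in>internal_verts p. cv a = c"
    using p(2) by (auto simp: total_monochromatic_def)
  moreover have "set r \<subseteq> verts G" "path_edges p \<subseteq> edges G" "u \<notin> set r" "v \<notin> set r"
    using p(1) r by (auto simp: path_between_def)
  ultimately show ?thesis
    by (intro that[of x y c]) auto
qed

text \<open>Equal or adjacent vertices are joined by a path with at most one edge and no internal
  vertex, which is monochromatic under every coloring.\<close>

lemma tmc_coloringI:
  assumes "\<And>u v. \<lbrakk>u \<in> verts G; v \<in> verts G; u \<noteq> v; {u, v} \<notin> edges G\<rbrakk> \<Longrightarrow>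
    \<exists>p. path_between G u p v \<and> total_monochromatic cv ce p"
  shows "tmc_coloring G cv ce"
  unfolding tmc_coloring_def
proof (intro ballI)
  fix u v assume uv: "u \<in> verts G" "v \<in> verts G"
  consider "u = v" | "{u, v} \<in> edges G" "u \<noteq> v" | "{u, v} \<notin> edges G" "u \<noteq> v" by blast
  then show "\<exists>p. path_between G u p v \<and> total_monochromatic cv ce p"
  proof cases
    case 1
    then have "path_between G u [u] v \<and> total_monochromatic cv ce [u]"
      using uv by (auto simp: path_between_def total_monochromatic_def path_edges_singleton
          internal_verts_def)
    then show ?thesis by blast
  next
    case 2
    then have "path_between G u [u, v] v \<and> total_monochromatic cv ce [u, v]"
      using uv by (auto simp: path_between_def total_monochromatic_def path_edges_singleton
          path_edges_Cons internal_verts_def)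
    then show ?thesis by blast
  next
    case 3
    then show ?thesis using assms uv by blast
  qed
qed

section \<open>Loss of colors through color classes\<close>

text \<open>All of \<open>S\<close> contributes one value and each other element at most one more.
  The additive form avoids truncated subtraction and covers empty \<open>S\<close>.\<close>

lemma card_image_constant_on:
  assumes "finite X" "S \<subseteq> X" "\<And>s. s \<in> S \<Longrightarrow> f s = c"
  shows "card (f ` X) + card S \<le> card X + 1"
proof -
  have "f ` X \<subseteq> insert c (f ` (X - S))" using assms(3) by auto
  then have "card (f ` X) \<le> card (insert c (f ` (X - S)))"
    by (rule card_mono[rotated]) (simp add: assms(1))
  also have "\<dots> \<le> Suc (card (f ` (X - S)))"
    by (simp add: card_insert_if assms(1))
  also have "\<dots> \<le> Suc (card (X - S))"
    by (simp add: card_image_le assms(1))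
  finally show ?thesis
    using assms(1,2) card_Diff_subset[of S X] card_mono[of X S] finite_subset[of S X] by simp
qed

text \<open>The three elements are two edges and an inner vertex.\<close>

lemma nonadjacent_color_class:
  assumes "tmc_coloring G cv ce" "u \<in> verts G" "v \<in> verts G" "u \<noteq> v" "{u, v} \<notin> edges G"
  obtains c S where "S \<subseteq> elements G" "\<And>s. s \<in> S \<Longrightarrow> case_sum cv ce s = c"
    "finite S" "3 \<le> card S"
    "card S = 3 \<Longrightarrow> \<exists>x. x \<notin> {u, v} \<and> S = {Inl x, Inr {u, x}, Inr {v, x}}"
proof -
  obtain c x y where xy: "x \<in> verts G" "y \<in> verts G" "x \<notin> {u, v}" "y \<notin> {u, v}"
    "{u, x} \<in> edges G" "{y, v} \<in> edges G"
    "cv x = c" "cv y = c" "ce {u, x} = c" "ce {y, v} = c"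
    using nonadjacent_monochromatic[OF assms] by metis
  let ?S = "{Inl x, Inl y, Inr {u, x}, Inr {y, v}}"
  \<comment> \<open>Equality would identify \<open>u\<close> with \<open>y\<close> or with
    \<open>v\<close>. Hence the listed set has three elements if \<open>x = y\<close> and four
    otherwise.\<close>
  have ne: "{u, x} \<noteq> {y, v}" using xy assms(4) by (auto simp: doubleton_eq_iff)
  show ?thesis
  proof (rule that[of ?S c])
    show "?S \<subseteq> elements G" using xy by (auto simp: elements_def)
    show "\<And>s. s \<in> ?S \<Longrightarrow> case_sum cv ce s = c" using xy by auto
    show "3 \<le> card ?S" using ne by (cases "x = y") auto
    assume "card ?S = 3"
    then have "x = y" using ne by (cases "x = y") auto
    then show "\<exists>z. z \<notin> {u, v} \<and> ?S = {Inl z, Inr {u, z}, Inr {v, z}}"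
      using xy by (intro exI[of _ x]) (auto simp: insert_commute)
  qed simp
qed

lemma two_nonadjacent_pairs_bound:
  assumes G: "simple_graph G" and col: "tmc_coloring G cv ce"
    and uv: "u \<in> verts G" "v \<in> verts G" "u \<noteq> v" "{u, v} \<notin> edges G"
    and wz: "w \<in> verts G" "z \<in> verts G" "w \<noteq> z" "{w, z} \<notin> edges G"
    and ne: "{u, v} \<noteq> {w, z}"
  shows "card (colors_used G cv ce) + 3 \<le> card (verts G) + card (edges G)"
proof -
  let ?f = "case_sum cv ce" and ?X = "elements G"
  have fin: "finite ?X" by (rule finite_elements[OF G])
  obtain c S where S: "S \<subseteq> ?X" "\<And>s. s \<in> S \<Longrightarrow> ?f s = c" "finite S" "3 \<le> card S"
    and S3: "card S = 3 \<Longrightarrow> \<exists>x. x \<notin> {u, v} \<and> S = {Inl x, Inr {u, x}, Inr {v, x}}"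
    using nonadjacent_color_class[OF col uv] by metis
  obtain d T where T: "T \<subseteq> ?X" "\<And>s. s \<in> T \<Longrightarrow> ?f s = d" "finite T" "3 \<le> card T"
    and T3: "card T = 3 \<Longrightarrow> \<exists>x. x \<notin> {w, z} \<and> T = {Inl x, Inr {w, x}, Inr {z, x}}"
    using nonadjacent_color_class[OF col wz] by metis
  have "card (?f ` ?X) + 3 \<le> card ?X"
  proof (cases "c = d")
    case True
    \<comment> \<open>Three elements would force \<open>S = T\<close>, and this set determines its
      nonadjacent pair.\<close>
    have "card (S \<union> T) \<noteq> 3"
    proof
      assume *: "card (S \<union> T) = 3"
      have "S = S \<union> T" "T = S \<union> T"
        using * S(3,4) T(3,4) by (intro card_seteq; simp)+
      then have "S = T" by simp
      with * S3 T3 obtain x y where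
        "x \<notin> {u, v}" and S1: "S = {Inl x, Inr {u, x}, Inr {v, x}}" and
        "y \<notin> {w, z}" and S2: "S = {Inl y, Inr {w, y}, Inr {z, y}}" by auto
      have "x = y" using S1 S2 by blast
      \<comment> \<open>The preimage under \<open>Inr\<close> consists of the two edges in
        \<open>S\<close>. Removing their common vertex from their union leaves the pair of other
        ends.\<close>
      have "\<Union> (Inr -` S) = {u, v, x}" by (auto simp: S1)
      moreover have "\<Union> (Inr -` S) = {w, z, x}" by (auto simp: S2 \<open>x = y\<close>)
      ultimately have "{u, v, x} - {x} = {w, z, x} - {x}" by simp
      moreover have "{u, v, x} - {x} = {u, v}" using \<open>x \<notin> {u, v}\<close> by auto
      moreover have "{w, z, x} - {x} = {w, z}" using \<open>y \<notin> {w, z}\<close> \<open>x = y\<close> by auto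
      ultimately have "{u, v} = {w, z}" by simp
      with ne show False ..
    qed
    moreover have "card S \<le> card (S \<union> T)" using S T by (intro card_mono) auto
    ultimately have "4 \<le> card (S \<union> T)" using S(4) by linarith
    moreover have "card (?f ` ?X) + card (S \<union> T) \<le> card ?X + 1"
      using S T True by (intro card_image_constant_on[OF fin, of _ _ c]) auto
    ultimately show ?thesis by linarith
  next
    case False
    then have disj: "S \<inter> T = {}" using S(2) T(2) by fastforce
    \<comment> \<open>Outside \<open>T\<close> all of \<open>S\<close> survives and costs two
      colors. Putting \<open>T\<close> back adds at least three elements but at most the color
      \<open>d\<close>, a further loss of two.\<close>
    have "card (?f ` (?X - T)) + card S \<le> card (?X - T) + 1"
      using S disj fin by (intro card_image_constant_on[of _ _ _ c]) auto
    moreover have "card (?f ` ?X) \<le> card (insert d (?f ` (?X - T)))"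
      using T(2) fin by (intro card_mono) auto
    moreover have "card (insert d (?f ` (?X - T))) \<le> card (?f ` (?X - T)) + 1"
      by (simp add: card_insert_if fin)
    moreover have "card (?X - T) = card ?X - card T" "card T \<le> card ?X"
      using T fin by (simp_all add: card_Diff_subset card_mono)
    ultimately show ?thesis using S(4) T(4) by linarith
  qed
  then show ?thesis by (simp add: colors_used_eq_image card_elements[OF G])
qed

section \<open>Colorings of complete graphs with at most one edge removed\<close>

text \<open>Without nonadjacent pairs every coloring qualifies, in particular an injective one on
  the elements.\<close>

lemma tmc_complete:
  assumes G: "simple_graph G" and "edges G = nsets (verts G) 2"
  shows "card (verts G) + card (edges G) \<le> tmc G"
proof -
  obtain f :: "'a + 'a set \<Rightarrow> nat" where f: "inj_on f (elements G)"
    using finite_imp_inj_to_nat_seg[OF finite_elements[OF G]] by blast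
  have "case_sum (f \<circ> Inl) (f \<circ> Inr) = f" by (simp add: fun_eq_iff split: sum.split)
  then have "card (colors_used G (f \<circ> Inl) (f \<circ> Inr)) = card (elements G)"
    by (simp add: colors_used_eq_image card_image f)
  moreover have "tmc_coloring G (f \<circ> Inl) (f \<circ> Inr)"
    by (rule tmc_coloringI) (use assms(2) in \<open>auto simp: nsets_def\<close>)
  ultimately show ?thesis
    using card_colors_used_le_tmc[OF G] card_elements[OF G] by metis
qed

lemma tmc_complete_minus_edge:
  assumes conn: "connected_graph G" and uv: "u \<in> verts G" "v \<in> verts G" "u \<noteq> v"
    and E: "edges G = nsets (verts G) 2 - {{u, v}}"
  shows "tmc G + 2 = card (verts G) + card (edges G)"
proof -
  have G: "simple_graph G" using conn by (simp add: connected_graph_def)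
  have nonadj: "{u, v} \<notin> edges G" using E by simp
  have "tmc G \<le> card (verts G) + card (edges G) - 2"
  proof (rule tmc_le[OF conn])
    fix cv ce assume "tmc_coloring G cv ce"
    then obtain c S where S: "S \<subseteq> elements G" "\<And>s. s \<in> S \<Longrightarrow> case_sum cv ce s = c" "3 \<le> card S"
      using nonadjacent_color_class[OF _ uv nonadj] by metis
    have "card (colors_used G cv ce) + card S \<le> card (elements G) + 1"
      unfolding colors_used_eq_image
      by (rule card_image_constant_on[OF finite_elements[OF G] S(1,2)])
    then show "card (colors_used G cv ce) \<le> card (verts G) + card (edges G) - 2"
      using S(3) card_elements[OF G] by linarith
  qed
  moreover have "card (verts G) + card (edges G) \<le> tmc G + 2"
  proof -
    \<comment> \<open>A third vertex exists because connectedness forces an inner vertex between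
      \<open>u\<close> and \<open>v\<close>; the constant coloring serves only to extract it. As
      \<open>{u, v}\<close> is the only missing edge, \<open>x\<close> is adjacent to both.\<close>
    obtain x where x: "x \<in> verts G" "x \<notin> {u, v}"
      using nonadjacent_monochromatic[OF tmc_coloring_const[OF conn] uv nonadj] by metis
    then have edges: "{u, x} \<in> edges G" "{v, x} \<in> edges G"
      using uv by (auto simp: E nsets_def doubleton_eq_iff)
    define S where "S = {Inl x, Inr {u, x}, Inr {v, x}}"
    have S: "S \<subseteq> elements G" "card S = 3" "finite S"
      using x edges uv by (auto simp: S_def elements_def doubleton_eq_iff)
    obtain h :: "'a + 'a set \<Rightarrow> nat" where h: "inj_on h (elements G)"
      using finite_imp_inj_to_nat_seg[OF finite_elements[OF G]] by blast
    \<comment> \<open>Color 0 is reserved for the path through \<open>x\<close>; \<open>Suc\<close>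
      keeps the other elements, with pairwise distinct colors, away from it.\<close>
    define f where "f s = (if s \<in> S then 0 else Suc (h s))" for s
    have "f ` elements G = insert 0 (f ` (elements G - S))"
    proof -
      have "f ` S = {0}" by (auto simp: f_def S_def)
      moreover have "elements G = S \<union> (elements G - S)" using S by blast
      ultimately show ?thesis by (metis image_Un insert_is_Un)
    qed
    moreover have "0 \<notin> f ` (elements G - S)" by (auto simp: f_def)
    moreover have "inj_on f (elements G - S)" using h by (auto simp: inj_on_def f_def)
    ultimately have "card (f ` elements G) = card (elements G) - 3 + 1"
      using S finite_elements[OF G] by (simp add: card_image card_Diff_subset)
    moreover have "case_sum (f \<circ> Inl) (f \<circ> Inr) = f"
      by (simp add: fun_eq_iff split: sum.split)
    ultimately have "card (elements G) \<le> card (colors_used G (f \<circ> Inl) (f \<circ> Inr)) + 2"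
      by (simp add: colors_used_eq_image)
    moreover have "tmc_coloring G (f \<circ> Inl) (f \<circ> Inr)"
    proof (rule tmc_coloringI)
      fix a b assume ab: "a \<in> verts G" "b \<in> verts G" "a \<noteq> b" "{a, b} \<notin> edges G"
      then have "{a, b} = {u, v}" by (auto simp: E nsets_def)
      then have "path_between G a [a, x, b] b \<and>
          total_monochromatic (f \<circ> Inl) (f \<circ> Inr) [a, x, b]"
        using ab x edges
        by (auto simp: path_between_def total_monochromatic_def path_edges_Cons
            path_edges_singleton internal_verts_def doubleton_eq_iff f_def S_def insert_commute)
      then show "\<exists>p. path_between G a p b \<and> total_monochromatic (f \<circ> Inl) (f \<circ> Inr) p"
        by blast
    qed
    then have "card (colors_used G (f \<circ> Inl) (f \<circ> Inr)) \<le> tmc G"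
      by (rule card_colors_used_le_tmc[OF G])
    ultimately show ?thesis using card_elements[OF G] by linarith
  qed
  \<comment> \<open>Ensures that the subtraction of 2 in the upper bound is not truncated.\<close>
  moreover have "3 \<le> card (verts G) + card (edges G)"
  proof -
    obtain S where "S \<subseteq> elements G" "3 \<le> card S"
      using nonadjacent_color_class[OF tmc_coloring_const[OF conn] uv nonadj] by metis
    then show ?thesis
      using card_mono[OF finite_elements[OF G], of S] card_elements[OF G] by linarith
  qed
  ultimately show ?thesis by linarith
qed

section \<open>Removing an edge up to isomorphism\<close>

text \<open>Injectivity of \<open>f\<close> makes the image map injective on subsets of
  \<open>V\<close>, so it commutes with set difference.\<close>

lemma image_nsets_minus_edge:
  assumes "bij_betw f V W" "u \<in> V" "v \<in> V"
  shows "image f ` (nsets V 2 - {{u, v}}) = nsets W 2 - {{f u, f v}}"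
proof -
  have "image f ` nsets V 2 = nsets W 2"
    using assms(1) bij_betw_nsets bij_betw_imp_surj_on by metis
  moreover have "inj_on (image f) (Pow V)"
    using assms(1) by (simp add: bij_betw_def inj_on_image_Pow)
  then have "image f ` (nsets V 2 - {{u, v}}) = image f ` nsets V 2 - image f ` {{u, v}}"
    by (rule inj_on_image_set_diff) (use assms in \<open>auto simp: nsets_def\<close>)
  ultimately show ?thesis by simp
qed

lemma edges_complete_graph_2: "edges (complete_graph 2) = {{0, 1}}"
proof -
  have "{..<2} = {0, 1 :: nat}" by auto
  then show ?thesis by (auto simp: complete_graph_def nsets_def card_2_iff doubleton_eq_iff)
qed

text \<open>Replaces the embedding and the isomorphism by a missing pair inside \<open>G\<close>,
  the form required by \<open>tmc_complete_minus_edge\<close>.\<close>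

lemma is_complete_minus_edge_iff:
  assumes G: "simple_graph G"
  shows "is_complete_minus (card (verts G)) (complete_graph 2) G \<longleftrightarrow>
    (\<exists>u\<in>verts G. \<exists>v\<in>verts G. u \<noteq> v \<and> edges G = nsets (verts G) 2 - {{u, v}})"
    (is "?L \<longleftrightarrow> ?R")
proof
  let ?n = "card (verts G)"
  assume ?L
  then obtain g f where g: "inj_on g {..<2::nat}" "g ` {..<2::nat} \<subseteq> {..<?n}"
    and f: "bij_betw f (verts G) {..<?n}"
    and E: "nsets {..<?n} 2 - {{g 0, g 1}} = image f ` edges G"
    unfolding is_complete_minus_def graph_iso_def edges_complete_graph_2
    by (auto simp: complete_graph_def)
  have "g 0 \<noteq> g 1"
    using inj_on_contraD[OF g(1), of 0 1] by simp
  moreover have "g 0 \<in> f ` verts G" "g 1 \<in> f ` verts G"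
    using g(2) bij_betw_imp_surj_on[OF f] by (simp_all add: image_subset_iff)
  \<comment> \<open>The ends of the deleted edge are pulled back along \<open>f\<close>.\<close>
  ultimately obtain u v where uv: "u \<in> verts G" "v \<in> verts G" "f u = g 0" "f v = g 1" "u \<noteq> v"
    by (metis imageE)
  \<comment> \<open>Both edge sets have the same image, and injectivity on subsets of
    \<open>verts G\<close> cancels it.\<close>
  have "image f ` edges G = image f ` (nsets (verts G) 2 - {{u, v}})"
    using image_nsets_minus_edge[OF f uv(1,2)] E uv by simp
  moreover have "inj_on (image f) (Pow (verts G))"
    using f by (simp add: bij_betw_def inj_on_image_Pow)
  moreover have "edges G \<subseteq> Pow (verts G)" "nsets (verts G) 2 - {{u, v}} \<subseteq> Pow (verts G)"
    using G by (auto simp: simple_graph_def nsets_def)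
  ultimately have "edges G = nsets (verts G) 2 - {{u, v}}"
    by (simp add: inj_on_image_eq_iff)
  then show ?R using uv by blast
next
  let ?n = "card (verts G)"
  assume ?R
  then obtain u v where uv: "u \<in> verts G" "v \<in> verts G" "u \<noteq> v"
    and E: "edges G = nsets (verts G) 2 - {{u, v}}" by blast
  obtain f where f: "bij_betw f (verts G) {..<?n}"
    using ex_bij_betw_finite_nat[OF simple_graph_finite(1)[OF G]]
    by (auto simp: atLeast0LessThan)
  define g :: "nat \<Rightarrow> nat" where "g i = (if i = 0 then f u else f v)" for i
  have "f u \<noteq> f v" "f u < ?n" "f v < ?n"
    using f uv by (auto simp: bij_betw_def inj_on_def)
  then have "inj_on g {..<2}" "g ` {..<2} \<subseteq> {..<?n}"
    by (auto simp: inj_on_def g_def less_2_cases_iff)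
  moreover have "nsets {..<?n} 2 - {{g 0, g 1}} = image f ` edges G"
    using image_nsets_minus_edge[OF f uv(1,2)] E by (simp add: g_def)
  ultimately show ?L
    unfolding is_complete_minus_def graph_iso_def edges_complete_graph_2
    using f by (intro exI[of _ g] conjI exI[of _ f]) (auto simp: complete_graph_def)
qed

section \<open>From the value of \<open>tmc\<close> to the missing edge and back\<close>

theorem theorem7:
  fixes G :: "'a ugraph" and n m :: nat
  assumes "connected_graph G"
    and "n = card (verts G)"
    and "m = card (edges G)"
  shows "int (tmc G) = int m + int n - 2 \<longleftrightarrow> is_complete_minus n (complete_graph 2) G"
proof -
  have G: "simple_graph G" using assms(1) by (simp add: connected_graph_def)
  \<comment> \<open>The additive form over the naturals agrees with the integer equation even when
    \<open>m + n < 2\<close>.\<close>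
  have "int (tmc G) = int m + int n - 2 \<longleftrightarrow> tmc G + 2 = card (verts G) + card (edges G)"
    using assms(2,3) by linarith
  also have "\<dots> \<longleftrightarrow>
    (\<exists>u\<in>verts G. \<exists>v\<in>verts G. u \<noteq> v \<and> edges G = nsets (verts G) 2 - {{u, v}})"
  proof
    assume tmc: "tmc G + 2 = card (verts G) + card (edges G)"
    have sub: "edges G \<subseteq> nsets (verts G) 2" using G by (simp add: simple_graph_def)
    \<comment> \<open>A complete graph would have a \<open>tmc\<close> too large by two.\<close>
    have "edges G \<noteq> nsets (verts G) 2" using tmc_complete[OF G] tmc by linarith
    with sub obtain e where e: "e \<in> nsets (verts G) 2" "e \<notin> edges G" by blast
    then obtain u v where uv: "e = {u, v}" "u \<in> verts G" "v \<in> verts G" "u \<noteq> v"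
      by (auto simp: nsets_def card_2_iff)
    \<comment> \<open>A second missing edge would cost a third color.\<close>
    have "e' = e" if e': "e' \<in> nsets (verts G) 2" "e' \<notin> edges G" for e'
    proof (rule ccontr)
      assume "e' \<noteq> e"
      obtain w z where wz: "e' = {w, z}" "w \<in> verts G" "z \<in> verts G" "w \<noteq> z"
        using e' by (auto simp: nsets_def card_2_iff)
      have bound: "card (colors_used G cv ce) + 3 \<le> card (verts G) + card (edges G)"
        if "tmc_coloring G cv ce" for cv ce
        using two_nonadjacent_pairs_bound[OF G that uv(2-4) _ wz(2-4)] uv wz e e' \<open>e' \<noteq> e\<close>
        by auto
      then have "tmc G \<le> card (verts G) + card (edges G) - 3"
        by (intro tmc_le[OF assms(1)]) fastforce
      \<comment> \<open>The bound for a constant coloring shows that there are at least three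
        elements, so subtracting 3 is not truncated.\<close>
      then show False using tmc bound[OF tmc_coloring_const[OF assms(1), of 0]] by linarith
    qed
    with e sub have "edges G = nsets (verts G) 2 - {e}" by blast
    with uv show "\<exists>u\<in>verts G. \<exists>v\<in>verts G. u \<noteq> v \<and> edges G = nsets (verts G) 2 - {{u, v}}"
      by blast
  next
    assume "\<exists>u\<in>verts G. \<exists>v\<in>verts G. u \<noteq> v \<and> edges G = nsets (verts G) 2 - {{u, v}}"
    then show "tmc G + 2 = card (verts G) + card (edges G)"
      using tmc_complete_minus_edge[OF assms(1)] by blast
  qed
  also have "\<dots> \<longleftrightarrow> is_complete_minus n (complete_graph 2) G"
    using is_complete_minus_edge_iff[OF G] assms(2) by simp
  finally show ?thesis .
qed

end
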